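(* Let $n \ge 2$ and $r \ge 1$ be integers, let $C$ be a real symmetric $n \times n$ matrix, and let $z \in \{\pm 1\}^n$. Let $L(z) := \operatorname{ddiag}(C z z^T) - C$, and suppose $L(z) \succeq 0$ with $\lambda_2(L(z)) > 0$. Let $D$ be any (strictly) positive definite diagonal $n \times n$ matrix, and set $L_D(z) := D^{-1/2} L(z) D^{-1/2}$. If $$ r > \frac{\lambda_n(L_D(z))}{\lambda_2(L_D(z))}, $$ then every second-order critical point $Y$ of the optimization problem $$ \max_{Y \in \mathbf{R}^{n \times r}} \ \langle C, Y Y^T \rangle \quad \text{subject to} \quad \operatorname{diag}(Y Y^T) = \mathbf{1} $$ is a global optimum of this problem and satisfies $Y Y^T = z z^T$.
   Context: Notation: $\langle A, B\rangle = \operatorname{tr}(A^T B)$ is the Euclidean (Frobenius) inner product; $\mathbf{1}$ is the all-ones vector in $\mathbf{R}^n$; for a square matrix $A$, $\operatorname{diag}(A)$ is the vector of its diagonal entries and $\operatorname{ddiag}(A)$ is the diagonal matrix with the same diagonal as $A$. The eigenvalues of a symmetric $n\times n$ matrix $A$ are denoted in increasing order $\lambda_1(A) \le \cdots \le \lambda_n(A)$. Second-order critical point: a feasible point $Y \in \mathbf{R}^{n\times r}$ (i.e. $\operatorname{diag}(YY^T) = \mathbf{1}$, so each row of $Y$ is a unit vector) at which the Riemannian gradient of the objective on the product of unit spheres is zero and the Riemannian Hessian is negative semidefinite. Equivalently, with $S(Y) := \operatorname{ddiag}(C Y Y^T) - C$, one has $S(Y) Y = 0$ and $\langle S(Y),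 \dot Y \dot Y^T\rangle \ge 0$ for all $\dot Y \in \mathbf{R}^{n \times r}$ with $\operatorname{diag}(Y \dot Y^T) = 0$. *)

theory Defs
  imports "HOL-Analysis.Analysis" "HOL-Computational_Algebra.Polynomial"
begin

text \<open>An \<open>n \<times> r\<close> matrix has type \<open>real^'r^'n\<close>, where \<open>n = CARD('n)\<close> and \<open>r = CARD('r)\<close>.
  The inner product of this type is the Frobenius inner product:\<close>

lemma inner_eq_trace: "A \<bullet> B = trace (transpose A ** B)" for A B :: "real^'r^'n"
  by (simp add: inner_vec_def trace_def matrix_matrix_mult_def transpose_def)
     (rule sum.swap)

definition mat_diag :: "real^'n^'n \<Rightarrow> real^'n" where
  "mat_diag A = (\<chi> i. A $ i $ i)"

definition ddiag :: "real^'n^'n \<Rightarrow> real^'n^'n" where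
  "ddiag A = (\<chi> i j. if i = j then A $ i $ i else 0)"

definition outer :: "real^'n \<Rightarrow> real^'n^'n" where
  "outer z = (\<chi> i j. z $ i * z $ j)"

definition symmetric_mat :: "real^'n^'n \<Rightarrow> bool" where
  "symmetric_mat A \<longleftrightarrow> transpose A = A"

definition diagonal_mat :: "real^'n^'n \<Rightarrow> bool" where
  "diagonal_mat A \<longleftrightarrow> (\<forall>i j. i \<noteq> j \<longrightarrow> A $ i $ j = 0)"

definition pos_semidef :: "real^'n^'n \<Rightarrow> bool" where
  "pos_semidef A \<longleftrightarrow> symmetric_mat A \<and> (\<forall>x. 0 \<le> x \<bullet> (A *v x))"

definition pos_def :: "real^'n^'n \<Rightarrow> bool" where
  "pos_def A \<longleftrightarrow> symmetric_mat A \<and> (\<forall>x. x \<noteq> 0 \<longrightarrow> 0 < x \<bullet> (A *v x))"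

definition charpoly :: "real^'n^'n \<Rightarrow> real poly" where
  "charpoly A = det (mat [:0, 1:] - map_matrix (\<lambda>a. [:a:]) A)"

text \<open>The \<open>k\<close>-th smallest eigenvalue, counted with multiplicity and starting at \<open>k = 1\<close>.
  It is meaningful for symmetric \<open>A\<close> (whose characteristic polynomial splits over the reals)
  and \<open>1 \<le> k \<le> CARD('n)\<close>.\<close>

definition eigval :: "nat \<Rightarrow> real^'n^'n \<Rightarrow> real" where
  "eigval k A = sorted_list_of_multiset (proots (charpoly A)) ! (k - 1)"

text \<open>\<open>D\<^sup>-\<^sup>1\<^sup>/\<^sup>2\<close>, for a positive definite diagonal matrix \<open>D\<close>.\<close>

definition diag_inv_sqrt :: "real^'n^'n \<Rightarrow> real^'n^'n" where
  "diag_inv_sqrt D = (\<chi> i j. if i = j then 1 / sqrt (D $ i $ i) else 0)"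

lemma pos_def_diagonal:
  assumes "pos_def D"
  shows "0 < D $ i $ i"
proof -
  have "0 < axis i 1 \<bullet> (D *v axis i 1)"
    using assms by (auto simp: pos_def_def axis_eq_0_iff)
  then show ?thesis
    by (simp add: matrix_vector_mul_component inner_axis inner_axis')
qed

text \<open>It is the positive definite square root of the inverse of \<open>D\<close>.\<close>

lemma diag_inv_sqrt:
  fixes D :: "real^'n^'n"
  assumes "pos_def D" "diagonal_mat D"
  shows "pos_def (diag_inv_sqrt D)"
    and "diag_inv_sqrt D ** diag_inv_sqrt D = matrix_inv D"
proof -
  let ?R = "diag_inv_sqrt D"
  note pos = pos_def_diagonal[OF assms(1)]
  have "?R *v x = (\<chi> i. x $ i / sqrt (D $ i $ i))" for x
    by (simp add: vec_eq_iff diag_inv_sqrt_def matrix_vector_mult_def if_distrib if_distribR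
        cong: if_cong)
  then have quad: "x \<bullet> (?R *v x) = (\<Sum>i\<in>UNIV. (x $ i)\<^sup>2 / sqrt (D $ i $ i))" for x
    by (simp add: inner_vec_def power2_eq_square)
  have "0 < x \<bullet> (?R *v x)" if nz: "x \<noteq> 0" for x
  proof -
    obtain i where "x $ i \<noteq> 0"
      using nz by (metis vec_eq_iff zero_index)
    then show ?thesis
      unfolding quad using pos by (intro sum_pos2[of _ i]) (auto simp: less_imp_le)
  qed
  moreover have "symmetric_mat ?R"
    by (simp add: symmetric_mat_def diag_inv_sqrt_def transpose_def vec_eq_iff)
  ultimately show "pos_def ?R"
    unfolding pos_def_def by blast
  have RR: "(?R ** ?R) $ i $ j = (if i = j then 1 / D $ i $ i else 0)" for i j
  proof -
    have "(?R ** ?R) $ i $ j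
        = (\<Sum>k\<in>UNIV. if k = i then (if i = j then 1 / D $ i $ i else 0) else 0)"
      unfolding matrix_matrix_mult_def vec_lambda_beta using pos[of i]
      by (intro sum.cong) (auto simp: diag_inv_sqrt_def)
    then show ?thesis
      by simp
  qed
  have nz: "D $ i $ i \<noteq> 0" for i
    using pos[of i] by simp
  have "(D ** (?R ** ?R)) $ i $ j = (\<Sum>k\<in>UNIV. if k = i then (if i = j then 1 else 0) else 0)" for i j
    by (subst matrix_matrix_mult_def, unfold vec_lambda_beta, intro sum.cong)
       (use nz assms(2) in \<open>auto simp: RR diagonal_mat_def\<close>)
  moreover have "(?R ** ?R ** D) $ i $ j = (\<Sum>k\<in>UNIV. if k = i then (if i = j then 1 else 0) else 0)" for i j
    by (subst matrix_matrix_mult_def, unfold vec_lambda_beta, intro sum.cong)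
       (use nz assms(2) in \<open>auto simp: RR diagonal_mat_def\<close>)
  moreover have "(\<Sum>k\<in>UNIV. if k = i then (if i = j then 1 else 0) else 0) = (mat 1 :: real^'n^'n) $ i $ j"
    for i j
    by (simp add: mat_def)
  ultimately have "D ** (?R ** ?R) = mat 1" "(?R ** ?R) ** D = mat 1"
    by (simp_all add: vec_eq_iff)
  then show "?R ** ?R = matrix_inv D"
    unfolding matrix_inv_def
    by (intro some_equality[symmetric]) (auto, metis matrix_mul_assoc matrix_mul_lid matrix_mul_rid)
qed

definition feasible :: "real^'r^'n \<Rightarrow> bool" where
  "feasible Y \<longleftrightarrow> mat_diag (Y ** transpose Y) = 1"

definition objective :: "real^'n^'n \<Rightarrow> real^'r^'n \<Rightarrow> real" where
  "objective C Y = C \<bullet> (Y ** transpose Y)"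

definition global_opt :: "real^'n^'n \<Rightarrow> real^'r^'n \<Rightarrow> bool" where
  "global_opt C Y \<longleftrightarrow> is_arg_max (objective C) feasible Y"

text \<open>The feasible set is a product of unit spheres, regarded as a Riemannian submanifold of
  \<open>real^'r^'n\<close>. Its tangent space at \<open>Y\<close> and the orthogonal projection onto it:\<close>

definition tangent :: "real^'r^'n \<Rightarrow> (real^'r^'n) set" where
  "tangent Y = {V. mat_diag (Y ** transpose V) = 0}"

definition tproj :: "real^'r^'n \<Rightarrow> real^'r^'n \<Rightarrow> real^'r^'n" where
  "tproj Y M = M - ddiag (M ** transpose Y) ** Y"

lemma diag_mult_transpose: "(A ** transpose B) $ i $ i = A $ i \<bullet> B $ i"
  for A B :: "real^'r^'n"
  by (simp add: inner_vec_def matrix_matrix_mult_def transpose_def)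

lemma feasible_iff_norm: "feasible Y \<longleftrightarrow> (\<forall>i. norm (Y $ i) = 1)"
  by (simp add: feasible_def mat_diag_def vec_eq_iff diag_mult_transpose norm_eq_1)

lemma tangent_iff: "V \<in> tangent Y \<longleftrightarrow> (\<forall>i. Y $ i \<bullet> V $ i = 0)"
  by (simp add: tangent_def mat_diag_def vec_eq_iff diag_mult_transpose)

lemma tproj_row: "tproj Y M $ i = M $ i - (M $ i \<bullet> Y $ i) *\<^sub>R Y $ i"
proof -
  have "(ddiag (M ** transpose Y) ** Y) $ i $ j = (M $ i \<bullet> Y $ i) * Y $ i $ j" for j
    by (subst matrix_matrix_mult_def)
       (simp add: ddiag_def diag_mult_transpose if_distrib if_distribR cong: if_cong)
  then show ?thesis
    by (simp add: tproj_def vec_eq_iff)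
qed

lemma tproj_orthogonal_projection:
  assumes "feasible Y"
  shows "tproj Y M \<in> tangent Y"
    and "V \<in> tangent Y \<Longrightarrow> (M - tproj Y M) \<bullet> V = 0"
proof -
  show "tproj Y M \<in> tangent Y"
    using assms by (simp add: tangent_iff tproj_row feasible_iff_norm norm_eq_1 inner_diff_right
        inner_commute)
  show "(M - tproj Y M) \<bullet> V = 0" if "V \<in> tangent Y"
    using that by (simp add: tangent_iff tproj_row inner_vec_def[of "M - _" V])
qed

definition egrad :: "(real^'r^'n \<Rightarrow> real) \<Rightarrow> real^'r^'n \<Rightarrow> real^'r^'n" where
  "egrad f Y = (THE G. GDERIV f Y :> G)"

text \<open>The formula for \<open>rgrad f\<close> makes sense for every matrix, so it extends the Riemannian
  gradient smoothly to the whole space. The Riemannian connection of a submanifold is the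
  tangential part of the ambient derivative, and the derivative of a vector field in a tangent
  direction does not depend on the chosen extension; this gives the Hessian below.\<close>

definition rgrad :: "(real^'r^'n \<Rightarrow> real) \<Rightarrow> real^'r^'n \<Rightarrow> real^'r^'n" where
  "rgrad f Y = tproj Y (egrad f Y)"

definition rhess :: "(real^'r^'n \<Rightarrow> real) \<Rightarrow> real^'r^'n \<Rightarrow> real^'r^'n \<Rightarrow> real^'r^'n" where
  "rhess f Y V = tproj Y (frechet_derivative (rgrad f) (at Y) V)"

definition second_order_critical :: "real^'n^'n \<Rightarrow> real^'r^'n \<Rightarrow> bool" where
  "second_order_critical C Y \<longleftrightarrow>
     feasible Y \<and> rgrad (objective C) Y = 0 \<and>
     (\<forall>V \<in> tangent Y. V \<bullet> rhess (objective C) Y V \<le> 0)"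

definition Lmat :: "real^'n^'n \<Rightarrow> real^'n \<Rightarrow> real^'n^'n" where
  "Lmat C z = ddiag (C ** outer z) - C"

definition LDmat :: "real^'n^'n \<Rightarrow> real^'n^'n \<Rightarrow> real^'n \<Rightarrow> real^'n^'n" where
  "LDmat D C z = diag_inv_sqrt D ** Lmat C z ** diag_inv_sqrt D"

end

theory Submission
  imports Defs
begin

text \<open>
  Put \<open>y\<^sub>i = z\<^sub>i Y\<^sub>i\<close>, \<open>a\<^sub>i\<^sub>j = z\<^sub>i z\<^sub>j L\<^sub>i\<^sub>j\<close> and \<open>x\<^sub>i\<^sub>j = y\<^sub>i \<bullet> y\<^sub>j\<close>. First-order criticality reads
  \<open>\<Sum>\<^sub>j a\<^sub>i\<^sub>j y\<^sub>j = \<Gamma>\<^sub>i y\<^sub>i\<close>, and since \<open>a\<close> has zero row sums it forces \<open>\<Sum>\<^sub>i \<Gamma>\<^sub>i y\<^sub>i = 0\<close>.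
  Second-order criticality, summed over the tangent directions \<open>V\<^sub>i = u - (u \<bullet> y\<^sub>i) y\<^sub>i\<close> with \<open>u\<close>
  running through an orthonormal basis, gives \<open>(r - 1) \<Sum> a\<^sub>i\<^sub>j x\<^sub>i\<^sub>j \<le> \<Sum> a\<^sub>i\<^sub>j x\<^sub>i\<^sub>j\<^sup>2\<close>.
  Let \<open>w\<close> be the \<open>D\<close>-weighted mean of the \<open>y\<^sub>i\<close>, let \<open>\<tau> = w \<bullet> w\<close>, and compare with the tensors
  \<open>\<phi>\<^sub>i = (y\<^sub>i - w) \<otimes> y\<^sub>i\<close>: the terms linear in \<open>w\<close> vanish because \<open>\<Sum>\<^sub>i \<Gamma>\<^sub>i y\<^sub>i = 0\<close>, so
  \<open>\<Sum> a\<^sub>i\<^sub>j \<phi>\<^sub>i \<bullet> \<phi>\<^sub>j \<ge> (r - 1 + \<tau>) \<Sum> a\<^sub>i\<^sub>j x\<^sub>i\<^sub>j\<close>. Normalise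
  \<open>tr D = 1\<close>. The eigenvalue \<open>\<lambda>\<^sub>n\<close> of \<open>L\<^sub>D\<close> bounds the left side above by \<open>\<lambda>\<^sub>n\<close> times the weighted
  variance of \<open>\<phi>\<close>, which is at most \<open>(1 - \<tau>) - (1 - \<tau>)\<^sup>2 / r = (1 - \<tau>) (r - 1 + \<tau>) / r\<close> because the
  mean of \<open>\<phi>\<close> has trace \<open>1 - \<tau>\<close>. The eigenvalue \<open>\<lambda>\<^sub>2\<close> bounds \<open>\<Sum> a\<^sub>i\<^sub>j x\<^sub>i\<^sub>j\<close> below by
  \<open>\<lambda>\<^sub>2 (1 - \<tau>)\<close>, as \<open>1 - \<tau>\<close> is the weighted variance of \<open>y\<close>.
  Hence \<open>\<tau> < 1\<close> would give \<open>r \<lambda>\<^sub>2 \<le> \<lambda>\<^sub>n\<close>; so \<open>\<tau> = 1\<close> and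
  all \<open>y\<^sub>i\<close> coincide.
\<close>

subsection \<open>Spectral theorem and ordered eigenvalues\<close>

text \<open>Let \<open>v\<close> maximise the Rayleigh quotient on the unit sphere of
  \<open>S\<close>. The residual \<open>w = f v - c v\<close> lies in \<open>S\<close> and is
  orthogonal to \<open>v\<close>, so moving from \<open>v\<close> to \<open>v + t w\<close> changes
  \<open>x \<bullet> f x - c (x \<bullet> x)\<close> by \<open>2 t (w \<bullet> w)\<close> plus a
  term quadratic in \<open>t\<close>. Maximality makes this change nonpositive for every
  \<open>t\<close>, hence \<open>w = 0\<close>.\<close>

lemma self_adjoint_eigenvector:
  fixes f :: "'a::euclidean_space \<Rightarrow> 'a"
  assumes lin: "linear f" and adj: "\<And>x y. f x \<bullet> y = x \<bullet> f y"
    and S: "subspace S" "S \<noteq> {0}" "f ` S \<subseteq> S"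
  obtains v c where "v \<in> S" "norm v = 1" "f v = c *\<^sub>R v"
proof -
  let ?K = "S \<inter> sphere 0 1"
  obtain x where x: "x \<in> S" "x \<noteq> 0"
    using S(1,2) subspace_0 by blast
  have "x /\<^sub>R norm x \<in> ?K"
    using x S(1) by (simp add: subspace_scale)
  moreover have "compact ?K"
    using S(1) by (simp add: closed_Int_compact closed_subspace)
  moreover have "continuous_on ?K (\<lambda>x. x \<bullet> f x)"
    by (intro continuous_intros linear_continuous_on linear_conv_bounded_linear[THEN iffD1] lin)
  ultimately obtain v where v: "v \<in> ?K" and max: "\<And>x. x \<in> ?K \<Longrightarrow> x \<bullet> f x \<le> v \<bullet> f v"
    using continuous_attains_sup[of ?K "\<lambda>x. x \<bullet> f x"] by blast
  define c where "c = v \<bullet> f v"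
  have vv: "v \<bullet> v = 1"
    using v by (simp add: norm_eq_1)
  have rayleigh: "x \<bullet> f x \<le> c * (x \<bullet> x)" if "x \<in> S" for x
  proof (cases "x = 0")
    case False
    let ?y = "x /\<^sub>R norm x"
    have "?y \<in> ?K"
      using that False S(1) by (simp add: subspace_scale)
    from max[OF this] have "(x \<bullet> f x) / (norm x)\<^sup>2 \<le> c"
      by (simp add: c_def linear_scale[OF lin] power2_eq_square divide_inverse mult_ac)
    then show ?thesis
      using False by (simp add: pos_divide_le_eq power2_norm_eq_inner)
  qed simp
  define w where "w = f v - c *\<^sub>R v"
  have wS: "w \<in> S"
    using v S(1,3) by (auto simp: w_def intro!: subspace_diff subspace_scale)
  have vw: "v \<bullet> w = 0" "w \<bullet> v = 0"
    by (simp_all add: w_def inner_diff_right inner_diff_left vv c_def inner_commute)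
  have quad: "2 * t * (w \<bullet> w) \<le> t\<^sup>2 * (c * (w \<bullet> w) - w \<bullet> f w)" for t
  proof -
    have "v + t *\<^sub>R w \<in> S"
      using v wS S(1) by (auto intro!: subspace_add subspace_scale)
    from rayleigh[OF this]
    have "c + 2 * t * (w \<bullet> f v) + t\<^sup>2 * (w \<bullet> f w) \<le> c * (1 + t\<^sup>2 * (w \<bullet> w))"
      by (simp add: linear_add[OF lin] linear_scale[OF lin] inner_add_left inner_add_right vv vw
          c_def[symmetric] adj[of v w, symmetric] inner_commute[of "f v"] power2_eq_square
          algebra_simps)
    moreover have "w \<bullet> w = w \<bullet> f v"
      by (subst (2) w_def) (simp add: inner_diff_right vw)
    ultimately show ?thesis
      by (simp add: algebra_simps)
  qed
  have "w \<bullet> w \<le> 0"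
  proof (rule ccontr)
    let ?k = "c * (w \<bullet> w) - w \<bullet> f w"
    assume "\<not> w \<bullet> w \<le> 0"
    then have pos: "0 < w \<bullet> w" by linarith
    \<comment> \<open>After division by \<open>t\<close>, \<open>quad\<close> reads
      \<open>2 (w \<bullet> w) \<le> t ?k\<close>. This \<open>t\<close> is small enough to bound
      the right side by \<open>w \<bullet> w\<close>; the summand 1 keeps the denominator positive
      when \<open>?k = 0\<close>.\<close>
    define t where "t = (w \<bullet> w) / (\<bar>?k\<bar> + 1)"
    have t: "0 < t" "t * (\<bar>?k\<bar> + 1) = w \<bullet> w"
      using pos by (simp_all add: t_def)
    have "2 * (w \<bullet> w) \<le> t * ?k"
      using quad[of t] t(1) by (simp add: power2_eq_square)
    also have "\<dots> \<le> t * (\<bar>?k\<bar> + 1)"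
      using t(1) by (intro mult_left_mono) auto
    finally show False
      using t(2) pos by simp
  qed
  then have "w = 0"
    by (metis inner_gt_zero_iff not_less)
  then have "f v = c *\<^sub>R v"
    by (simp add: w_def)
  with v that show thesis
    by auto
qed

text \<open>Induction on the dimension: after one eigenvector \<open>v\<close> is split off, its
  orthogonal complement within \<open>S\<close> is again invariant, by self-adjointness. Allowing
  any invariant subspace is what makes the induction go through.\<close>

lemma self_adjoint_eigenbasis_subspace:
  fixes f :: "'a::euclidean_space \<Rightarrow> 'a"
  assumes lin: "linear f" and adj: "\<And>x y. f x \<bullet> y = x \<bullet> f y"
    and "subspace S" "f ` S \<subseteq> S"
  shows "\<exists>B \<subseteq> S. pairwise orthogonal B \<and> span B = S \<and>
    (\<forall>v \<in> B. norm v = 1 \<and> (\<exists>c. f v = c *\<^sub>R v))"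
  using assms(3,4)
proof (induction "dim S" arbitrary: S rule: less_induct)
  case less
  show ?case
  proof (cases "S = {0}")
    case True
    then show ?thesis
      by (intro exI[of _ "{}"]) auto
  next
    case False
    then obtain v c where v: "v \<in> S" "norm v = 1" "f v = c *\<^sub>R v"
      using self_adjoint_eigenvector[OF lin adj less.prems(1) _ less.prems(2)] by blast
    define T where "T = {x \<in> S. orthogonal v x}"
    have T: "subspace T"
      using less.prems(1) subspace_orthogonal_to_vector[of v]
      by (auto simp: T_def subspace_def)
    have "v \<notin> T"
      using v(2) by (auto simp: T_def orthogonal_def)
    then have "T \<subset> S"
      using v(1) by (auto simp: T_def)
    then have "dim T < dim S"
      by (metis T less.prems(1) dim_psubset span_eq_iff)
    moreover have "f ` T \<subseteq> T"
      using less.prems(2) v(3) by (auto simp: T_def orthogonal_def adj[symmetric])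
    ultimately obtain B where B: "B \<subseteq> T" "pairwise orthogonal B" "span B = T"
      "\<forall>v \<in> B. norm v = 1 \<and> (\<exists>c. f v = c *\<^sub>R v)"
      using less.hyps T by blast
    have "S \<subseteq> span (insert v B)"
    proof
      fix x assume x: "x \<in> S"
      have "x - (x \<bullet> v) *\<^sub>R v \<in> T"
        using x v less.prems(1)
        by (auto simp: T_def orthogonal_def inner_diff_right norm_eq_1 inner_commute
            intro!: subspace_diff subspace_scale)
      then show "x \<in> span (insert v B)"
        using B(3) by (auto simp: span_insert)
    qed
    moreover have "span (insert v B) \<subseteq> S"
      using B(1) v(1) less.prems(1) by (intro span_minimal) (auto simp: T_def)
    moreover have "pairwise orthogonal (insert v B)"
      using B(1,2) by (auto simp: pairwise_insert T_def orthogonal_commute)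
    ultimately show ?thesis
      using B(1,4) v by (intro exI[of _ "insert v B"]) (auto simp: T_def)
  qed
qed

text \<open>Indexing by the type \<open>'n\<close> itself fixes the right number of vectors for a
  basis and lets sums over \<open>UNIV\<close> count eigenvalues with multiplicity.\<close>

definition eigenbasis :: "real^'n^'n \<Rightarrow> ('n \<Rightarrow> real^'n) \<Rightarrow> ('n \<Rightarrow> real) \<Rightarrow> bool" where
  "eigenbasis A b \<mu> \<longleftrightarrow> (\<forall>i j. b i \<bullet> b j = (if i = j then 1 else 0)) \<and> (\<forall>i. A *v b i = \<mu> i *\<^sub>R b i)"

lemma symmetric_mat_adjoint:
  assumes "symmetric_mat A"
  shows "(A *v x) \<bullet> y = x \<bullet> (A *v y)"
  using assms by (metis dot_lmul_matrix symmetric_mat_def transpose_matrix_vector)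

lemma symmetric_mat_eigenbasis:
  fixes A :: "real^'n^'n"
  assumes "symmetric_mat A"
  obtains b \<mu> where "eigenbasis A b \<mu>"
proof -
  obtain B where B: "pairwise orthogonal B" "span B = UNIV"
    "\<forall>v \<in> B. norm v = 1 \<and> (\<exists>c. A *v v = c *\<^sub>R v)"
    using self_adjoint_eigenbasis_subspace[of "(*v) A" UNIV] symmetric_mat_adjoint[OF assms]
    by auto
  have indep: "independent B"
    using B(1,3) by (intro pairwise_orthogonal_independent) auto
  then have "card B = CARD('n)"
    using B(2) by (metis DIM_cart DIM_real dim_UNIV dim_eq_card_independent dim_span mult.right_neutral)
  moreover have "finite B"
    using indep by (rule finiteI_independent)
  ultimately obtain b where b: "bij_betw b (UNIV :: 'n set) B"
    by (metis finite_same_card_bij finite)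
  then have bB: "b i \<in> B" for i
    by (auto simp: bij_betw_def)
  then have "\<forall>i. \<exists>c. A *v b i = c *\<^sub>R b i"
    using B(3) by blast
  then obtain \<mu> where "\<forall>i. A *v b i = \<mu> i *\<^sub>R b i"
    by metis
  moreover have "b i \<bullet> b j = (if i = j then 1 else 0)" for i j
    using B(1,3) b bB by (auto simp: norm_eq_1 pairwise_def orthogonal_def bij_betw_def inj_eq)
  ultimately show thesis
    by (intro that) (auto simp: eigenbasis_def)
qed

lemma eigenbasis_expand:
  fixes A :: "real^'n^'n"
  assumes "eigenbasis A b \<mu>"
  shows "x = (\<Sum>i\<in>UNIV. (x \<bullet> b i) *\<^sub>R b i)"
proof -
  have b: "b i \<bullet> b j = (if i = j then 1 else 0)" for i j
    using assms by (simp add: eigenbasis_def)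
  then have inj: "inj b"
    by (metis injI zero_neq_one)
  have orth: "pairwise orthogonal (range b)"
    using b by (auto simp: pairwise_def orthogonal_def)
  have norm: "norm v = 1" if "v \<in> range b" for v
    using that b by (auto simp: norm_eq_1)
  then have "independent (range b)"
    using orth by (intro pairwise_orthogonal_independent) (metis norm_zero zero_neq_one)+
  moreover have "card (range b) = DIM(real^'n)"
    using inj by (simp add: card_image)
  ultimately have "span (range b) = UNIV"
    by (metis dim_UNIV dim_eq_card_independent dim_eq_full)
  then have "(\<Sum>v\<in>range b. (x \<bullet> v) *\<^sub>R v) = x"
    using orth norm by (intro orthonormal_basis_expand) auto
  then show ?thesis
    by (simp add: sum.reindex[OF inj])
qed

lemma eigenbasis_inner:
  assumes "eigenbasis A b \<mu>"
  shows "x \<bullet> y = (\<Sum>i\<in>UNIV. (x \<bullet> b i) * (y \<bullet> b i))"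
proof -
  have "x \<bullet> y = (\<Sum>i\<in>UNIV. (x \<bullet> b i) *\<^sub>R b i) \<bullet> y"
    using eigenbasis_expand[OF assms, of x] by simp
  then show ?thesis
    by (simp add: inner_sum_left inner_commute[of y])
qed

lemma eigenbasis_quadratic_form:
  fixes A :: "real^'n^'n"
  assumes "symmetric_mat A" "eigenbasis A b \<mu>"
  shows "x \<bullet> (A *v x) = (\<Sum>i\<in>UNIV. \<mu> i * (x \<bullet> b i)\<^sup>2)"
proof -
  have "(A *v x) \<bullet> b i = \<mu> i * (x \<bullet> b i)" for i
    using assms by (simp add: symmetric_mat_adjoint eigenbasis_def)
  then show ?thesis
    by (subst eigenbasis_inner[OF assms(2)]) (simp add: power2_eq_square mult_ac)
qed

section \<open>Eigenvalues as roots of the characteristic polynomial\<close>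

lemma matrix_mult_diff_left: "(A - B) ** C = A ** C - B ** C"
  for A B :: "'a::ring_1^'m^'n"
  by (simp add: vec_eq_iff matrix_matrix_mult_def left_diff_distrib sum_subtractf)

lemma matrix_mult_diff_right: "A ** (B - C) = A ** B - A ** C"
  for A :: "'a::ring_1^'m^'n"
  by (simp add: vec_eq_iff matrix_matrix_mult_def right_diff_distrib sum_subtractf)

text \<open>With the eigenvectors as columns of \<open>P\<close>, one has
  \<open>A P = P \<Lambda>\<close>. Embedding the entries as constant polynomials respects products,
  and scalar matrices commute with everything, so \<open>X - A\<close> and
  \<open>X - \<Lambda>\<close> are intertwined by \<open>P\<close> and have equal determinants once
  \<open>det P\<close> is cancelled.\<close>

lemma charpoly_eigenbasis:
  fixes A :: "real^'n^'n"
  assumes "eigenbasis A b \<mu>"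
  shows "charpoly A = (\<Prod>i\<in>UNIV. [:- \<mu> i, 1:])"
proof -
  let ?c = "map_matrix (\<lambda>a::real. [:a:])"
  define P :: "real^'n^'n" where "P = (\<chi> i j. b j $ i)"
  define \<Lambda> :: "real^'n^'n" where "\<Lambda> = (\<chi> i j. if i = j then \<mu> i else 0)"
  have "A ** P = P ** \<Lambda>"
  proof -
    have "(A ** P) $ i $ j = (P ** \<Lambda>) $ i $ j" for i j
    proof -
      have "(A ** P) $ i $ j = (A *v b j) $ i"
        by (simp add: matrix_matrix_mult_def matrix_vector_mult_def P_def)
      also have "\<dots> = \<mu> j * b j $ i"
        using assms by (simp add: eigenbasis_def)
      also have "\<dots> = (P ** \<Lambda>) $ i $ j"
        by (simp add: matrix_matrix_mult_def P_def \<Lambda>_def if_distrib cong: if_cong)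
      finally show ?thesis .
    qed
    then show ?thesis
      by (simp add: vec_eq_iff)
  qed
  moreover have hom: "?c (M ** N) = ?c M ** ?c N" for M N :: "real^'n^'n"
  proof -
    have "[:sum f X:] = (\<Sum>k\<in>X. [:f k:])" for f :: "'n \<Rightarrow> real" and X
      by (simp add: poly_eq_iff coeff_sum coeff_pCons split: nat.split)
    then show ?thesis
      by (simp add: vec_eq_iff matrix_matrix_mult_def mult.commute)
  qed
  ultimately have "?c A ** ?c P = ?c P ** ?c \<Lambda>"
    by metis
  moreover have "mat [:0, 1:] ** M = M ** mat [:0, 1:]" for M :: "real poly^'n^'n"
    by (simp add: vec_eq_iff matrix_matrix_mult_def mat_def if_distrib if_distribR mult.commute
        cong: if_cong)
  ultimately have "(mat [:0, 1:] - ?c A) ** ?c P = ?c P ** (mat [:0, 1:] - ?c \<Lambda>)"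
    by (simp add: matrix_mult_diff_left matrix_mult_diff_right)
  then have "charpoly A * det (?c P) = det (?c P) * det (mat [:0, 1:] - ?c \<Lambda>)"
    unfolding charpoly_def by (metis (no_types) det_mul)
  \<comment> \<open>Polynomials form only an integral domain, so \<open>det P\<close> is cancelled
    as a nonzero factor; orthonormality makes it a unit.\<close>
  moreover have "det (?c P) \<noteq> 0"
  proof -
    have "transpose P ** P = mat 1"
      using assms by (simp add: vec_eq_iff matrix_matrix_mult_def transpose_def P_def mat_def
          eigenbasis_def inner_vec_def)
    moreover have "?c (mat 1) = (mat 1 :: real poly^'n^'n)"
      by (simp add: vec_eq_iff mat_def one_pCons)
    ultimately have "det (?c (transpose P)) * det (?c P) = 1"
      by (metis det_I det_mul hom)
    then show ?thesis
      by auto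
  qed
  ultimately have "charpoly A = det (mat [:0, 1:] - ?c \<Lambda>)"
    by simp
  also have "\<dots> = (\<Prod>i\<in>UNIV. [:- \<mu> i, 1:])"
    by (subst det_diagonal) (auto simp: mat_def \<Lambda>_def)
  finally show ?thesis .
qed

text \<open>This links \<open>eigval\<close>, defined through polynomial roots, to eigenvectors.
  Sorting the indices by \<mu>, rather than the values alone, remembers which eigenvector belongs to
  the k-th eigenvalue. List positions start at 0 and \<open>eigval\<close> at 1, hence
  \<open>Suc k\<close>.\<close>

lemma symmetric_mat_sorted_eigenbasis:
  fixes A :: "real^'n^'n"
  assumes "symmetric_mat A"
  obtains b \<mu> js where "eigenbasis A b \<mu>" "distinct js" "set js = UNIV" "sorted (map \<mu> js)"
    "length js = CARD('n)" "\<forall>k < CARD('n). eigval (Suc k) A = \<mu> (js ! k)"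
proof -
  obtain b \<mu> where b: "eigenbasis A b \<mu>"
    using symmetric_mat_eigenbasis[OF assms] .
  obtain ks :: "'n list" where ks: "set ks = UNIV" "distinct ks"
    using finite_distinct_list[of "UNIV :: 'n set"] by auto
  let ?js = "sort_key \<mu> ks"
  have "proots (charpoly A) = (\<Sum>i\<in>UNIV. {#\<mu> i#})"
    by (simp add: charpoly_eigenbasis[OF b] proots_prod)
  also have "\<dots> = mset (map \<mu> ks)"
    using ks by (simp add: sum_unfold_sum_mset mset_set_set[symmetric])
  finally have "sorted_list_of_multiset (proots (charpoly A)) = sort (map \<mu> ks)"
    by (metis sorted_list_of_multiset_mset)
  also have "\<dots> = map \<mu> ?js"
    by (intro properties_for_sort) auto
  finally have "sorted_list_of_multiset (proots (charpoly A)) = map \<mu> ?js" .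
  moreover have len: "length ?js = CARD('n)"
    using ks by (metis distinct_card length_sort)
  ultimately have "\<forall>k < CARD('n). eigval (Suc k) A = \<mu> (?js ! k)"
    by (simp add: eigval_def)
  then show thesis
    using b ks len by (intro that[of b \<mu> ?js]) auto
qed

section \<open>Quadratic forms bounded by ordered eigenvalues\<close>

lemma eigenbasis_inner_self:
  assumes "eigenbasis A b \<mu>"
  shows "x \<bullet> x = (\<Sum>i\<in>UNIV. (x \<bullet> b i)\<^sup>2)"
  by (subst eigenbasis_inner[OF assms]) (simp add: power2_eq_square)

lemma quadratic_form_le_eigval_max:
  fixes A :: "real^'n^'n"
  assumes "symmetric_mat A"
  shows "x \<bullet> (A *v x) \<le> eigval CARD('n) A * (x \<bullet> x)"
proof -
  obtain b \<mu> js where b: "eigenbasis A b \<mu>"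
    and js: "distinct js" "set js = UNIV" "sorted (map \<mu> js)"
    and len: "length js = CARD('n)"
    and eig: "\<forall>k < CARD('n). eigval (Suc k) A = \<mu> (js ! k)"
    using symmetric_mat_sorted_eigenbasis[OF assms] .
  have "\<mu> i \<le> eigval CARD('n) A" for i
  proof -
    obtain k where k: "k < CARD('n)" "i = js ! k"
      using js(2) len by (metis UNIV_I in_set_conv_nth)
    then have "map \<mu> js ! k \<le> map \<mu> js ! (CARD('n) - 1)"
      using js(3) len by (intro sorted_nth_mono) auto
    then show ?thesis
      using k eig[rule_format, of "CARD('n) - 1"] len by simp
  qed
  then have "(\<Sum>i\<in>UNIV. \<mu> i * (x \<bullet> b i)\<^sup>2) \<le> (\<Sum>i\<in>UNIV. eigval CARD('n) A * (x \<bullet> b i)\<^sup>2)"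
    by (intro sum_mono mult_right_mono) auto
  then show ?thesis
    by (simp add: eigenbasis_quadratic_form[OF assms b] eigenbasis_inner_self[OF b] sum_distrib_left)
qed

lemma eigval_mono:
  fixes A :: "real^'n^'n"
  assumes "symmetric_mat A" "1 \<le> k" "k \<le> l" "l \<le> CARD('n)"
  shows "eigval k A \<le> eigval l A"
proof -
  obtain b \<mu> js where b: "eigenbasis A b \<mu>"
    and js: "distinct js" "set js = UNIV" "sorted (map \<mu> js)"
    and len: "length js = CARD('n)"
    and eig: "\<forall>k < CARD('n). eigval (Suc k) A = \<mu> (js ! k)"
    using symmetric_mat_sorted_eigenbasis[OF assms(1)] .
  have "map \<mu> js ! (k - 1) \<le> map \<mu> js ! (l - 1)"
    using js(3) len assms by (intro sorted_nth_mono) auto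
  then show ?thesis
    using eig[rule_format, of "k - 1"] eig[rule_format, of "l - 1"] len assms by simp
qed

lemma pos_semidef_eigenvalue_nonneg:
  assumes "pos_semidef A" "eigenbasis A b \<mu>"
  shows "0 \<le> \<mu> i"
proof -
  have "0 \<le> b i \<bullet> (A *v b i)"
    using assms(1) by (auto simp: pos_semidef_def)
  then show ?thesis
    using assms(2) by (simp add: eigenbasis_def)
qed

text \<open>If the second eigenvalue is positive, the kernel vector \<open>q\<close> is orthogonal
  to every eigenvector but the first, hence a multiple of the first. So \<open>x\<close> has no
  component there, and only eigenvalues at least \<open>eigval 2 A\<close> contribute. Otherwise the
  left side is nonpositive and semidefiniteness suffices.\<close>

lemma quadratic_form_ge_eigval_2:
  fixes A :: "real^'n^'n"
  assumes n: "CARD('n) \<ge> 2" and psd: "pos_semidef A"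
    and q: "A *v q = 0" "q \<noteq> 0" and x: "x \<bullet> q = 0"
  shows "eigval 2 A * (x \<bullet> x) \<le> x \<bullet> (A *v x)"
proof (cases "eigval 2 A > 0")
  case False
  moreover have "0 \<le> x \<bullet> (A *v x)"
    using psd by (simp add: pos_semidef_def)
  ultimately show ?thesis
    by (meson inner_ge_zero mult_nonpos_nonneg not_less order_trans)
next
  case True
  have sym: "symmetric_mat A"
    using psd by (simp add: pos_semidef_def)
  obtain b \<mu> js where b: "eigenbasis A b \<mu>"
    and js: "distinct js" "set js = UNIV" "sorted (map \<mu> js)"
    and len: "length js = CARD('n)"
    and eig: "\<forall>k < CARD('n). eigval (Suc k) A = \<mu> (js ! k)"
    using symmetric_mat_sorted_eigenbasis[OF sym] .
  have ge: "eigval 2 A \<le> \<mu> i" if "i \<noteq> js ! 0" for i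
  proof -
    obtain k where k: "k < CARD('n)" "i = js ! k"
      using js(2) len by (metis UNIV_I in_set_conv_nth)
    then have "1 \<le> k"
      using that by (cases k) auto
    then have "map \<mu> js ! 1 \<le> map \<mu> js ! k"
      using js(3) len k by (intro sorted_nth_mono) auto
    then show ?thesis
      using k eig[rule_format, of 1] len n by (simp add: numeral_2_eq_2)
  qed
  have q_orth: "q \<bullet> b i = 0" if "i \<noteq> js ! 0" for i
  proof -
    have "0 = q \<bullet> (A *v b i)"
      using q(1) symmetric_mat_adjoint[OF sym, of q "b i"] by simp
    then have "\<mu> i * (q \<bullet> b i) = 0"
      using b by (simp add: eigenbasis_def)
    then show ?thesis
      using ge[OF that] True by simp
  qed
  have "(\<Sum>i\<in>UNIV. (q \<bullet> b i) *\<^sub>R b i) = (q \<bullet> b (js ! 0)) *\<^sub>R b (js ! 0)"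
    by (subst sum.mono_neutral_right[of _ "{js ! 0}"]) (auto simp: q_orth)
  then have q_eq: "q = (q \<bullet> b (js ! 0)) *\<^sub>R b (js ! 0)"
    using eigenbasis_expand[OF b, of q] by simp
  then have "(q \<bullet> b (js ! 0)) * (x \<bullet> b (js ! 0)) = 0"
    using x by (metis inner_scaleR_right)
  moreover have "q \<bullet> b (js ! 0) \<noteq> 0"
    using q_eq q(2) by (metis scaleR_zero_left)
  ultimately have x0: "x \<bullet> b (js ! 0) = 0"
    by simp
  have "eigval 2 A * (x \<bullet> b i)\<^sup>2 \<le> \<mu> i * (x \<bullet> b i)\<^sup>2" for i
    using ge[of i] x0 by (cases "i = js ! 0") (auto intro: mult_right_mono)
  then show ?thesis
    by (simp add: eigenbasis_quadratic_form[OF sym b] eigenbasis_inner_self[OF b] sum_distrib_left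
        sum_mono)
qed

text \<open>The assumption \<open>ker\<close> says that the kernel is at most one-dimensional. Were
  the second eigenvalue not positive, semidefiniteness would make the two smallest vanish, and their
  eigenvectors would be orthogonal unit vectors in the kernel.\<close>

lemma eigval_2_pos:
  fixes A :: "real^'n^'n"
  assumes n: "CARD('n) \<ge> 2" and psd: "pos_semidef A"
    and ker: "\<And>x y. A *v x = 0 \<Longrightarrow> A *v y = 0 \<Longrightarrow> x \<bullet> y = 0 \<Longrightarrow> x = 0 \<or> y = 0"
  shows "eigval 2 A > 0"
proof (rule ccontr)
  assume neg: "\<not> eigval 2 A > 0"
  have sym: "symmetric_mat A"
    using psd by (simp add: pos_semidef_def)
  obtain b \<mu> js where b: "eigenbasis A b \<mu>"
    and js: "distinct js" "set js = UNIV" "sorted (map \<mu> js)"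
    and len: "length js = CARD('n)"
    and eig: "\<forall>k < CARD('n). eigval (Suc k) A = \<mu> (js ! k)"
    using symmetric_mat_sorted_eigenbasis[OF sym] .
  note nonneg = pos_semidef_eigenvalue_nonneg[OF psd b]
  have "\<mu> (js ! 1) \<le> 0"
    using neg eig[rule_format, of 1] n by (simp add: numeral_2_eq_2)
  moreover have "map \<mu> js ! 0 \<le> map \<mu> js ! 1"
    using js(3) len n by (intro sorted_nth_mono) auto
  ultimately have "\<mu> (js ! 0) = 0" "\<mu> (js ! 1) = 0"
    using nonneg[of "js ! 0"] nonneg[of "js ! 1"] len n by auto
  moreover have "js ! 0 \<noteq> js ! 1"
    using js(1) len n by (simp add: nth_eq_iff_index_eq)
  ultimately have "b (js ! 0) = 0 \<or> b (js ! 1) = 0"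
    using b by (intro ker) (auto simp: eigenbasis_def)
  then show False
    using b by (metis eigenbasis_def inner_zero_left zero_neq_one)
qed

subsection \<open>Families of unit vectors critical for a Laplacian\<close>

text \<open>\<open>Q\<close> is a quadratic form and \<open>E\<close> the \<open>p\<close>-weighted
  variance. A comparison of the two for scalar families passes to vector families by applying it to
  each coordinate and summing over \<open>Basis\<close>.\<close>

lemma sum_inner_bounds:
  fixes a :: "'n::finite \<Rightarrow> 'n \<Rightarrow> real" and p :: "'n \<Rightarrow> real" and f :: "'n \<Rightarrow> 'a::euclidean_space"
  defines "Q \<equiv> \<lambda>x :: 'n \<Rightarrow> real. \<Sum>i\<in>UNIV. \<Sum>j\<in>UNIV. a i j * (x i * x j)"
    and "E \<equiv> \<lambda>x :: 'n \<Rightarrow> real. \<Sum>i\<in>UNIV. p i * (x i - (\<Sum>k\<in>UNIV. p k * x k))\<^sup>2"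
  defines "m \<equiv> (\<Sum>k\<in>UNIV. p k *\<^sub>R f k)"
  shows "(\<And>x. l * E x \<le> Q x) \<Longrightarrow>
      l * (\<Sum>i\<in>UNIV. p i * (norm (f i - m))\<^sup>2) \<le> (\<Sum>i\<in>UNIV. \<Sum>j\<in>UNIV. a i j * (f i \<bullet> f j))"
    and "(\<And>x. Q x \<le> u * E x) \<Longrightarrow>
      (\<Sum>i\<in>UNIV. \<Sum>j\<in>UNIV. a i j * (f i \<bullet> f j)) \<le> u * (\<Sum>i\<in>UNIV. p i * (norm (f i - m))\<^sup>2)"
proof -
  have "(\<Sum>b\<in>Basis. Q (\<lambda>i. f i \<bullet> b)) = (\<Sum>i\<in>UNIV. \<Sum>j\<in>UNIV. \<Sum>b\<in>Basis. a i j * ((f i \<bullet> b) * (f j \<bullet> b)))"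
    unfolding Q_def by (subst sum.swap, intro sum.cong refl, subst sum.swap, rule refl)
  then have Q: "(\<Sum>b\<in>Basis. Q (\<lambda>i. f i \<bullet> b)) = (\<Sum>i\<in>UNIV. \<Sum>j\<in>UNIV. a i j * (f i \<bullet> f j))"
    by (simp add: euclidean_inner[of "f _" "f _"] sum_distrib_left)
  have "(\<Sum>b\<in>Basis. E (\<lambda>i. f i \<bullet> b)) = (\<Sum>b\<in>Basis. \<Sum>i\<in>UNIV. p i * ((f i - m) \<bullet> b)\<^sup>2)"
    by (simp add: E_def m_def inner_diff_left inner_sum_left)
  also have "\<dots> = (\<Sum>i\<in>UNIV. p i * (\<Sum>b\<in>Basis. ((f i - m) \<bullet> b)\<^sup>2))"
    by (subst sum.swap) (simp add: sum_distrib_left)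
  also have "\<dots> = (\<Sum>i\<in>UNIV. p i * (norm (f i - m))\<^sup>2)"
    by (simp add: power2_norm_eq_inner euclidean_inner[of "_ - m" "_ - m"]) (simp add: power2_eq_square)
  finally have E: "(\<Sum>b\<in>Basis. E (\<lambda>i. f i \<bullet> b)) = (\<Sum>i\<in>UNIV. p i * (norm (f i - m))\<^sup>2)" .
  show "l * (\<Sum>i\<in>UNIV. p i * (norm (f i - m))\<^sup>2) \<le> (\<Sum>i\<in>UNIV. \<Sum>j\<in>UNIV. a i j * (f i \<bullet> f j))"
    if "\<And>x. l * E x \<le> Q x"
    unfolding Q[symmetric] E[symmetric] sum_distrib_left by (intro sum_mono that)
  show "(\<Sum>i\<in>UNIV. \<Sum>j\<in>UNIV. a i j * (f i \<bullet> f j)) \<le> u * (\<Sum>i\<in>UNIV. p i * (norm (f i - m))\<^sup>2)"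
    if "\<And>x. Q x \<le> u * E x"
    unfolding Q[symmetric] E[symmetric] sum_distrib_left by (intro sum_mono that)
qed

lemma weighted_variance:
  fixes f :: "'n::finite \<Rightarrow> 'a::real_inner"
  assumes "sum p UNIV = 1"
  defines "m \<equiv> (\<Sum>k\<in>UNIV. p k *\<^sub>R f k)"
  shows "(\<Sum>i\<in>UNIV. p i * (norm (f i - m))\<^sup>2) = (\<Sum>i\<in>UNIV. p i * (norm (f i))\<^sup>2) - (norm m)\<^sup>2"
proof -
  have "p i * (norm (f i - m))\<^sup>2 = p i * (norm (f i))\<^sup>2 - 2 * ((p i *\<^sub>R f i) \<bullet> m) + p i * (norm m)\<^sup>2" for i
    by (simp add: power2_norm_eq_inner inner_diff_left inner_diff_right inner_commute[of m "f i"]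
        algebra_simps)
  then have "(\<Sum>i\<in>UNIV. p i * (norm (f i - m))\<^sup>2)
      = (\<Sum>i\<in>UNIV. p i * (norm (f i))\<^sup>2) - 2 * (m \<bullet> m) + sum p UNIV * (norm m)\<^sup>2"
    by (simp add: sum.distrib sum_subtractf sum_distrib_left[symmetric] sum_distrib_right
        inner_sum_left[symmetric] m_def del: inner_scaleR_left)
  then show ?thesis
    using assms(1) by (simp add: power2_norm_eq_inner)
qed

text \<open>The core argument, free of matrices: the spectrum enters only through the comparison of
  \<open>Q\<close> with the variance \<open>E\<close>. In the application \<open>p\<close> is the
  normalised diagonal of \<open>D\<close>, while \<open>l\<close> and \<open>u\<close> are the
  second and the largest eigenvalue of \<open>LDmat D C z\<close> times the trace of
  \<open>D\<close>.\<close>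

lemma critical_vectors_constant:
  fixes a :: "'n::finite \<Rightarrow> 'n \<Rightarrow> real" and y :: "'n \<Rightarrow> real^'r" and p \<Gamma> :: "'n \<Rightarrow> real"
  defines "Q \<equiv> \<lambda>x :: 'n \<Rightarrow> real. \<Sum>i\<in>UNIV. \<Sum>j\<in>UNIV. a i j * (x i * x j)"
    and "E \<equiv> \<lambda>x :: 'n \<Rightarrow> real. \<Sum>i\<in>UNIV. p i * (x i - (\<Sum>k\<in>UNIV. p k * x k))\<^sup>2"
  assumes sym: "\<And>i j. a i j = a j i" and row: "\<And>i. (\<Sum>j\<in>UNIV. a i j) = 0"
    and p: "\<And>i. 0 < p i" "sum p UNIV = 1"
    and low: "\<And>x. l * E x \<le> Q x" and up: "\<And>x. Q x \<le> u * E x"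
    and lu: "l \<le> u" "0 < l" "u < real CARD('r) * l"
    and unit: "\<And>i. norm (y i) = 1"
    and crit: "\<And>i. (\<Sum>j\<in>UNIV. a i j *\<^sub>R y j) = \<Gamma> i *\<^sub>R y i"
    and hess: "\<And>V. (\<And>i. y i \<bullet> V i = 0) \<Longrightarrow>
      (\<Sum>i\<in>UNIV. \<Gamma> i * (norm (V i))\<^sup>2) \<le> (\<Sum>i\<in>UNIV. \<Sum>j\<in>UNIV. a i j * (V i \<bullet> V j))"
  shows "y i = (\<Sum>k\<in>UNIV. p k *\<^sub>R y k)"
proof -
  define w where "w = (\<Sum>k\<in>UNIV. p k *\<^sub>R y k)"
  define \<tau> where "\<tau> = w \<bullet> w"
  define r where "r = real CARD('r)"
  define X where "X = (\<Sum>i\<in>UNIV. \<Sum>j\<in>UNIV. a i j * (y i \<bullet> y j))"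
  define X2 where "X2 = (\<Sum>i\<in>UNIV. \<Sum>j\<in>UNIV. a i j * (y i \<bullet> y j)\<^sup>2)"
  have yy: "y i \<bullet> y i = 1" for i
    using unit by (simp add: norm_eq_1)
  have col: "(\<Sum>i\<in>UNIV. a i j) = 0" for j
    using row[of j] by (simp add: sym)
  have r1: "1 < r"
  proof -
    have "1 * l < r * l"
      unfolding r_def using lu(1,3) by linarith
    then show ?thesis
      using lu(2) mult_less_cancel_right_pos by blast
  qed
  have crit_inner: "(\<Sum>j\<in>UNIV. a i j * (v \<bullet> y j)) = \<Gamma> i * (v \<bullet> y i)" for i v
    using arg_cong[OF crit[of i], of "\<lambda>t. v \<bullet> t"] by (simp add: inner_sum_right)
  have trace: "sum \<Gamma> UNIV = X"
    by (simp add: X_def crit_inner yy)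
  \<comment> \<open>This is the vanishing of the \<Gamma>-weighted sum of the \<open>y i\<close>,
    tested against \<open>v\<close>: exchanging the sums leaves the column sums of
    \<open>a\<close>.\<close>
  have \<Gamma>0: "(\<Sum>i\<in>UNIV. \<Gamma> i * (v \<bullet> y i)) = 0" for v
  proof -
    have "(\<Sum>i\<in>UNIV. \<Gamma> i * (v \<bullet> y i)) = (\<Sum>j\<in>UNIV. \<Sum>i\<in>UNIV. a i j * (v \<bullet> y j))"
      unfolding crit_inner[symmetric] by (rule sum.swap)
    also have "\<dots> = 0"
      by (simp add: sum_distrib_right[symmetric] col)
    finally show ?thesis .
  qed
  have mixed: "(\<Sum>i\<in>UNIV. \<Sum>j\<in>UNIV. a i j * ((w \<bullet> y i) * (y i \<bullet> y j))) = 0"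
  proof -
    have "(\<Sum>j\<in>UNIV. a i j * ((w \<bullet> y i) * (y i \<bullet> y j))) = \<Gamma> i * (w \<bullet> y i)" for i
    proof -
      have "(\<Sum>j\<in>UNIV. a i j * ((w \<bullet> y i) * (y i \<bullet> y j)))
          = (w \<bullet> y i) * (\<Sum>j\<in>UNIV. a i j * (y i \<bullet> y j))"
        by (simp add: sum_distrib_left mult_ac)
      then show ?thesis
        by (simp add: crit_inner yy)
    qed
    then show ?thesis
      by (simp add: \<Gamma>0)
  qed
  have mixed': "(\<Sum>i\<in>UNIV. \<Sum>j\<in>UNIV. a i j * ((w \<bullet> y j) * (y i \<bullet> y j))) = 0"
    using mixed by (subst sum.swap) (simp add: sym[of _ _] inner_commute[of "y _" "y _"])
  have second: "(r - 1) * X \<le> X2"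
  proof -
    define V where "V u i = u - (u \<bullet> y i) *\<^sub>R y i" for u i
    \<comment> \<open>The left side is the trace of the product of the projections orthogonal to
      \<open>y i\<close> and to \<open>y j\<close>. For \<open>i = j\<close> it equals
      \<open>r - 1\<close>; in the double sum against \<open>a\<close> the constant
      \<open>r - 2\<close> is killed by the zero row sums.\<close>
    have VV: "(\<Sum>u\<in>Basis. V u i \<bullet> V u j) = r - 2 + (y i \<bullet> y j)\<^sup>2" for i j
    proof -
      have "V u i \<bullet> V u j = u \<bullet> u - (y i \<bullet> u) * (y i \<bullet> u) - (y j \<bullet> u) * (y j \<bullet> u)
          + ((y i \<bullet> u) * (y j \<bullet> u)) * (y i \<bullet> y j)" for u
        by (simp add: V_def inner_commute[of u "y _"] algebra_simps)
      then have "(\<Sum>u\<in>Basis. V u i \<bullet> V u j)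
          = (\<Sum>u\<in>Basis. u \<bullet> (u :: real^'r)) - y i \<bullet> y i - y j \<bullet> y j + (y i \<bullet> y j) * (y i \<bullet> y j)"
        by (simp only: sum.distrib sum_subtractf euclidean_inner[symmetric] sum_distrib_right[symmetric])
      moreover have "(\<Sum>u\<in>Basis. u \<bullet> (u :: real^'r)) = r"
        by (simp add: r_def)
      ultimately show ?thesis
        by (simp add: yy power2_eq_square)
    qed
    have "(\<Sum>u\<in>Basis. \<Sum>i\<in>UNIV. \<Gamma> i * (norm (V u i))\<^sup>2)
        \<le> (\<Sum>u\<in>Basis. \<Sum>i\<in>UNIV. \<Sum>j\<in>UNIV. a i j * (V u i \<bullet> V u j))"
      by (intro sum_mono hess) (simp add: V_def inner_diff_right yy inner_commute)
    moreover have "(\<Sum>u\<in>Basis. \<Sum>i\<in>UNIV. \<Gamma> i * (norm (V u i))\<^sup>2) = (r - 1) * X"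
    proof (subst sum.swap)
      have "(\<Sum>u\<in>Basis. \<Gamma> i * (norm (V u i))\<^sup>2) = (r - 1) * \<Gamma> i" for i
        by (simp only: power2_norm_eq_inner sum_distrib_left[symmetric] VV) (simp add: yy)
      then show "(\<Sum>i\<in>UNIV. \<Sum>u\<in>Basis. \<Gamma> i * (norm (V u i))\<^sup>2) = (r - 1) * X"
        by (simp only: sum_distrib_left[symmetric] trace)
    qed
    moreover have "(\<Sum>u\<in>Basis. \<Sum>i\<in>UNIV. \<Sum>j\<in>UNIV. a i j * (V u i \<bullet> V u j))
        = (\<Sum>i\<in>UNIV. \<Sum>j\<in>UNIV. a i j * (\<Sum>u\<in>Basis. V u i \<bullet> V u j))"
      by (subst sum.swap, intro sum.cong refl, subst sum.swap) (simp add: sum_distrib_left)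
    moreover have "\<dots> = X2"
      by (simp add: VV distrib_left sum.distrib X2_def sum_distrib_right[symmetric] row)
    ultimately show ?thesis
      by simp
  qed
  \<comment> \<open>Only the first tensor factor is centred, so the Gram entries yield
    \<open>X2\<close> together with a multiple \<tau> of \<open>X\<close>. The tensor is stored as a
    matrix so that \<open>sum_inner_bounds\<close> applies to it.\<close>
  define \<phi> :: "'n \<Rightarrow> real^'r^'r" where "\<phi> i = (\<chi> s t. (y i - w) $ s * y i $ t)" for i
  define m where "m = (\<Sum>k\<in>UNIV. p k *\<^sub>R \<phi> k)"
  have \<phi>: "\<phi> i \<bullet> \<phi> j = ((y i - w) \<bullet> (y j - w)) * (y i \<bullet> y j)" for i j
  proof -
    have "\<phi> i \<bullet> \<phi> j = (\<Sum>s\<in>UNIV. \<Sum>t\<in>UNIV. ((y i - w) $ s * (y j - w) $ s) * (y i $ t * y j $ t))"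
      by (simp add: inner_vec_def \<phi>_def mult_ac)
    then show ?thesis
      by (simp add: inner_vec_def sum_product)
  qed
  have spread: "(\<Sum>i\<in>UNIV. p i * (norm (y i - w))\<^sup>2) = 1 - \<tau>"
    using weighted_variance[OF p(2), of y]
    by (simp add: w_def[symmetric] unit p(2) \<tau>_def power2_norm_eq_inner)
  have \<tau>1: "\<tau> \<le> 1"
    using spread p(1) by (smt (verit) mult_nonneg_nonneg sum_nonneg zero_le_power2)
  have lower: "l * (1 - \<tau>) \<le> X"
    using sum_inner_bounds(1)[of l p a y] low
    by (simp add: w_def[symmetric] spread X_def Q_def E_def)
  have gram: "(\<Sum>i\<in>UNIV. \<Sum>j\<in>UNIV. a i j * (\<phi> i \<bullet> \<phi> j)) = X2 + \<tau> * X"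
  proof -
    have "a i j * (\<phi> i \<bullet> \<phi> j) = a i j * (y i \<bullet> y j)\<^sup>2 - a i j * ((w \<bullet> y i) * (y i \<bullet> y j))
        - a i j * ((w \<bullet> y j) * (y i \<bullet> y j)) + \<tau> * (a i j * (y i \<bullet> y j))" for i j
      by (simp add: \<phi> inner_diff_left inner_diff_right \<tau>_def inner_commute[of "y _" w]
          power2_eq_square algebra_simps)
    then show ?thesis
      by (simp add: sum.distrib sum_subtractf mixed mixed' X_def X2_def sum_distrib_left)
  qed
  \<comment> \<open>Since \<open>y i\<close> is a unit vector, \<phi> at \<open>i\<close> has the
    same norm as \<open>y i - w\<close>; the weighted mean of the squared norms is therefore given
    by \<open>spread\<close>.\<close>
  have upper: "(\<Sum>i\<in>UNIV. \<Sum>j\<in>UNIV. a i j * (\<phi> i \<bullet> \<phi> j)) \<le> u * (1 - \<tau> - (norm m)\<^sup>2)"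
    using sum_inner_bounds(2)[where a = a and f = \<phi> and u = u and p = p] up weighted_variance[OF p(2), of \<phi>]
    by (simp add: m_def[symmetric] Q_def E_def power2_norm_eq_inner \<phi> yy)
       (simp add: power2_norm_eq_inner[symmetric] spread)
  \<comment> \<open>Cauchy-Schwarz against the identity matrix, whose squared norm is
    \<open>r\<close> and whose inner product with a matrix is the trace. This is where the factor
    \<open>r\<close> is gained.\<close>
  have mean: "(1 - \<tau>)\<^sup>2 \<le> r * (norm m)\<^sup>2"
  proof -
    have inner_I: "\<phi> i \<bullet> mat 1 = 1 - w \<bullet> y i" for i
    proof -
      have "\<phi> i \<bullet> mat 1 = (y i - w) \<bullet> y i"
        by (simp add: inner_vec_def \<phi>_def mat_def if_distrib cong: if_cong)
      then show ?thesis
        by (simp add: inner_diff_left yy)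
    qed
    have "m \<bullet> mat 1 = sum p UNIV - (\<Sum>i\<in>UNIV. p i * (w \<bullet> y i))"
      by (simp add: m_def inner_sum_left inner_I right_diff_distrib sum_subtractf)
    also have "(\<Sum>i\<in>UNIV. p i * (w \<bullet> y i)) = w \<bullet> w"
      by (subst (3) w_def) (simp add: inner_sum_right)
    finally have "m \<bullet> mat 1 = 1 - \<tau>"
      by (simp add: p \<tau>_def)
    moreover have "(mat 1 :: real^'r^'r) \<bullet> mat 1 = r"
      by (simp add: inner_vec_def mat_def r_def if_distrib cong: if_cong)
    ultimately show ?thesis
      using Cauchy_Schwarz_ineq[of m "mat 1"] by (simp add: power2_norm_eq_inner mult.commute)
  qed
  have \<tau>0: "0 \<le> \<tau>"
    by (simp add: \<tau>_def)
  have "(r - 1 + \<tau>) * (l * (1 - \<tau>)) \<le> (r - 1 + \<tau>) * X"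
    using r1 \<tau>0 lower by (intro mult_left_mono) auto
  also have "\<dots> \<le> X2 + \<tau> * X"
    using second by (simp add: distrib_right)
  also have "\<dots> \<le> u * (1 - \<tau> - (norm m)\<^sup>2)"
    using upper gram by simp
  finally have "r * ((r - 1 + \<tau>) * (l * (1 - \<tau>))) \<le> r * (u * (1 - \<tau> - (norm m)\<^sup>2))"
    using r1 by (intro mult_left_mono) auto
  also have "\<dots> = u * (r * (1 - \<tau>) - r * (norm m)\<^sup>2)"
    by (simp add: algebra_simps)
  also have "\<dots> \<le> u * (r * (1 - \<tau>) - (1 - \<tau>)\<^sup>2)"
    using mean lu by (intro mult_left_mono) auto
  \<comment> \<open>\<open>r (1 - \<tau>) - (1 - \<tau>)\<^sup>2\<close> factors as
    \<open>(1 - \<tau>) (r - 1 + \<tau>)\<close>, the same product as on the left side.\<close>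
  finally have "(r * l - u) * ((r - 1 + \<tau>) * (1 - \<tau>)) \<le> 0"
    by (simp add: algebra_simps power2_eq_square)
  moreover have "0 < r * l - u" "0 < r - 1 + \<tau>"
    using lu r1 \<tau>0 by (auto simp: r_def)
  ultimately have "\<tau> = 1"
    using \<tau>1 by (simp add: mult_le_0_iff)
  then have "p i * (norm (y i - w))\<^sup>2 = 0"
    using spread p(1) sum_nonneg_eq_0_iff[of UNIV "\<lambda>i. p i * (norm (y i - w))\<^sup>2"]
    by (simp add: less_imp_le)
  then show ?thesis
    using p(1)[of i] by (simp add: w_def)
qed

subsection \<open>Criticality on the product of spheres\<close>

lemma matrix_mult_row: "(A ** B) $ i = (\<Sum>j\<in>UNIV. A $ i $ j *\<^sub>R B $ j)"
  for A :: "real^'m^'n"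
  by (simp add: vec_eq_iff matrix_matrix_mult_def)

lemma inner_matrix_mult:
  "V \<bullet> (A ** W) = (\<Sum>i\<in>UNIV. \<Sum>j\<in>UNIV. A $ i $ j * (V $ i \<bullet> W $ j))"
  for A :: "real^'m^'n"
  by (simp add: inner_vec_def[of V] matrix_mult_row inner_sum_right)

lemma inner_matrix_mult_symmetric:
  assumes "symmetric_mat A"
  shows "V \<bullet> (A ** W) = (A ** V) \<bullet> W"
proof -
  have A: "A $ i $ j = A $ j $ i" for i j
  proof -
    have "transpose A $ i $ j = A $ i $ j"
      using assms by (simp add: symmetric_mat_def)
    then show ?thesis
      by (simp add: transpose_def)
  qed
  show ?thesis
    unfolding inner_matrix_mult inner_commute[of "A ** V"]
    by (subst sum.swap) (simp add: A[of _ _] inner_commute[of "V $ _"])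
qed

lemma objective_eq_inner: "objective C Y = Y \<bullet> (C ** Y)"
proof -
  have "C \<bullet> (Y ** transpose Y) = (\<Sum>i\<in>UNIV. \<Sum>j\<in>UNIV. C $ i $ j * (Y $ i \<bullet> Y $ j))"
    by (simp add: inner_vec_def matrix_matrix_mult_def transpose_def)
  then show ?thesis
    by (simp add: objective_def inner_matrix_mult)
qed

lemma bounded_linear_matrix_mult: "bounded_linear (\<lambda>Y :: real^'r^'n. (C :: real^'n^'m) ** Y)"
  by (intro linear_conv_bounded_linear[THEN iffD1] linearI)
     (simp_all add: vec_eq_iff matrix_matrix_mult_def distrib_left sum.distrib sum_distrib_left mult_ac)

text \<open>The product rule gives two terms that agree by symmetry of \<open>C\<close>. As
  \<open>egrad\<close> is a definite description, uniqueness of the gradient is shown as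
  well.\<close>

lemma egrad_objective:
  fixes Y :: "real^'r^'n"
  assumes "symmetric_mat C"
  shows "egrad (objective C) Y = 2 *\<^sub>R (C ** Y)"
proof -
  have "((\<lambda>Y :: real^'r^'n. Y \<bullet> (C ** Y)) has_derivative (\<lambda>h. Y \<bullet> (C ** h) + h \<bullet> (C ** Y))) (at Y)"
    by (intro has_derivative_inner bounded_linear.has_derivative[OF bounded_linear_matrix_mult]
        has_derivative_ident)
  moreover have "Y \<bullet> (C ** h) + h \<bullet> (C ** Y) = h \<bullet> (2 *\<^sub>R (C ** Y))" for h
    by (simp add: inner_matrix_mult_symmetric[OF assms, of Y h] inner_commute)
  ultimately have deriv: "GDERIV (objective C) Y :> 2 *\<^sub>R (C ** Y)"
    by (simp add: gderiv_def objective_eq_inner[abs_def])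
  show ?thesis
    unfolding egrad_def
  proof (rule the_equality[where P = "\<lambda>G. GDERIV (objective C) Y :> G", OF deriv])
    fix G assume "GDERIV (objective C) Y :> G"
    then have "(\<lambda>h. h \<bullet> G) = (\<lambda>h. h \<bullet> (2 *\<^sub>R (C ** Y)))"
      using deriv unfolding gderiv_def by (rule has_derivative_unique)
    then show "G = 2 *\<^sub>R (C ** Y)"
      by (metis vector_eq_ldot)
  qed
qed

text \<open>With \<open>row_scale\<close>, this writes the normal part removed by
  \<open>tproj\<close> as \<open>row_scale (row_inner M Y) Y\<close>, a composition of bounded
  bilinear maps to which the product rule applies.\<close>

definition row_inner :: "real^'r^'n \<Rightarrow> real^'r^'n \<Rightarrow> real^'n" where
  "row_inner M Y = (\<chi> i. M $ i \<bullet> Y $ i)"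

definition row_scale :: "real^'n \<Rightarrow> real^'r^'n \<Rightarrow> real^'r^'n" where
  "row_scale k Y = (\<chi> i. k $ i *\<^sub>R Y $ i)"

lemma bounded_bilinear_row_inner: "bounded_bilinear row_inner"
  unfolding bilinear_conv_bounded_bilinear[symmetric] bilinear_def
  by (auto intro!: linearI simp: row_inner_def vec_eq_iff inner_add_left inner_add_right)

lemma bounded_bilinear_row_scale: "bounded_bilinear row_scale"
  unfolding bilinear_conv_bounded_bilinear[symmetric] bilinear_def
  by (auto intro!: linearI simp: row_scale_def vec_eq_iff algebra_simps)

text \<open>Both the outer projection and the derivative of the multipliers
  \<open>row_inner (C ** Y) Y\<close> contribute only multiples of the rows of \<open>Y\<close>.
  These are orthogonal to the rows of \<open>V\<close> and drop out of the inner product.\<close>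

lemma rhess_objective:
  fixes Y V :: "real^'r^'n"
  assumes C: "symmetric_mat C" and V: "V \<in> tangent Y"
  shows "V \<bullet> rhess (objective C) Y V
    = 2 * (V \<bullet> (C ** V) - (\<Sum>i\<in>UNIV. ((C ** Y) $ i \<bullet> Y $ i) * (norm (V $ i))\<^sup>2))"
proof -
  have tan: "V $ i \<bullet> Y $ i = 0" for i
    using V by (simp add: tangent_iff inner_commute)
  have grad: "rgrad (objective C) =
      (\<lambda>Y :: real^'r^'n. 2 *\<^sub>R (C ** Y - row_scale (row_inner (C ** Y) Y) Y))"
  proof
    fix Y :: "real^'r^'n"
    have "rgrad (objective C) Y $ i = (2 *\<^sub>R (C ** Y - row_scale (row_inner (C ** Y) Y) Y)) $ i" for i
      by (simp add: rgrad_def egrad_objective[OF C] tproj_row row_scale_def row_inner_def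
          scaleR_right_diff_distrib)
    then show "rgrad (objective C) Y = 2 *\<^sub>R (C ** Y - row_scale (row_inner (C ** Y) Y) Y)"
      by (subst vec_eq_iff) blast
  qed
  let ?H = "\<lambda>h. 2 *\<^sub>R (C ** h - (row_scale (row_inner (C ** Y) Y) h
      + row_scale (row_inner (C ** Y) h + row_inner (C ** h) Y) Y))"
  have "(rgrad (objective C) has_derivative ?H) (at Y)"
    unfolding grad
    by (intro has_derivative_scaleR_right has_derivative_diff
        bounded_bilinear.FDERIV[OF bounded_bilinear_row_scale]
        bounded_bilinear.FDERIV[OF bounded_bilinear_row_inner]
        bounded_linear.has_derivative[OF bounded_linear_matrix_mult] has_derivative_ident)
  then have "rhess (objective C) Y V = tproj Y (?H V)"
    by (simp add: rhess_def frechet_derivative_at[symmetric])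
  then have "V \<bullet> rhess (objective C) Y V = (\<Sum>i\<in>UNIV. V $ i \<bullet> ?H V $ i)"
    by (simp add: inner_vec_def[of V] tproj_row inner_diff_right tan)
  also have "\<dots> = (\<Sum>i\<in>UNIV. 2 * (V $ i \<bullet> (C ** V) $ i - ((C ** Y) $ i \<bullet> Y $ i) * (norm (V $ i))\<^sup>2))"
    by (intro sum.cong refl) (simp add: row_scale_def row_inner_def inner_diff_right inner_add_right tan
        power2_norm_eq_inner)
  also have "\<dots> = 2 * (V \<bullet> (C ** V) - (\<Sum>i\<in>UNIV. ((C ** Y) $ i \<bullet> Y $ i) * (norm (V $ i))\<^sup>2))"
    by (simp add: sum_distrib_left[symmetric] sum_subtractf inner_vec_def[of V "C ** V"])
  finally show ?thesis .
qed

text \<open>Row-wise forms of \<open>S(Y) Y = 0\<close> and of the inequality for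
  \<open>S(Y)\<close>: the number \<open>(C ** Y) $ i \<bullet> Y $ i\<close> is the i-th diagonal
  entry of \<open>C Y Y^T\<close>.\<close>

lemma second_order_critical_conditions:
  fixes Y V :: "real^'r^'n"
  assumes C: "symmetric_mat C" and crit: "second_order_critical C Y"
  shows "(C ** Y) $ i = ((C ** Y) $ i \<bullet> Y $ i) *\<^sub>R Y $ i"
    and "(\<And>i. Y $ i \<bullet> V $ i = 0) \<Longrightarrow>
      V \<bullet> (C ** V) \<le> (\<Sum>i\<in>UNIV. ((C ** Y) $ i \<bullet> Y $ i) * (norm (V $ i))\<^sup>2)"
proof -
  have "tproj Y (2 *\<^sub>R (C ** Y)) $ i = 0"
    using crit by (simp add: second_order_critical_def rgrad_def egrad_objective[OF C])
  then have "2 *\<^sub>R ((C ** Y) $ i - ((C ** Y) $ i \<bullet> Y $ i) *\<^sub>R Y $ i) = 0"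
    by (simp add: tproj_row scaleR_right_diff_distrib)
  then show "(C ** Y) $ i = ((C ** Y) $ i \<bullet> Y $ i) *\<^sub>R Y $ i"
    by simp
  assume "\<And>i. Y $ i \<bullet> V $ i = 0"
  then have V: "V \<in> tangent Y"
    by (simp add: tangent_iff)
  then have "V \<bullet> rhess (objective C) Y V \<le> 0"
    using crit by (simp add: second_order_critical_def)
  then show "V \<bullet> (C ** V) \<le> (\<Sum>i\<in>UNIV. ((C ** Y) $ i \<bullet> Y $ i) * (norm (V $ i))\<^sup>2)"
    using rhess_objective[OF C V] by simp
qed

subsection \<open>The preconditioned Laplacian\<close>

lemma Lmat_nth: "Lmat C z $ i $ j = (if i = j then z $ i * (C *v z) $ i else 0) - C $ i $ j"
  by (simp add: Lmat_def ddiag_def outer_def matrix_matrix_mult_def matrix_vector_mult_def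
      sum_distrib_left mult_ac)

lemma Lmat_mult_row:
  "(Lmat C z ** Y) $ i = (z $ i * (C *v z) $ i) *\<^sub>R Y $ i - (C ** Y) $ i"
  for Y :: "real^'r^'n"
  by (simp add: Lmat_nth matrix_mult_row scaleR_left_diff_distrib sum_subtractf
      if_distrib[of "\<lambda>c. c *\<^sub>R _"] cong: if_cong)

lemma Lmat_mult_vec_sign:
  assumes "\<And>i. (z $ i)\<^sup>2 = 1"
  shows "Lmat C z *v z = 0"
proof -
  have "(Lmat C z *v z) $ i = (z $ i)\<^sup>2 * (C *v z) $ i - (C *v z) $ i" for i
    by (simp add: Lmat_nth matrix_vector_mult_def[of "Lmat C z"] left_diff_distrib sum_subtractf
        if_distrib[of "\<lambda>c. c * _"] power2_eq_square cong: if_cong)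
       (simp add: matrix_vector_mult_def)
  then show ?thesis
    by (simp add: vec_eq_iff assms)
qed

lemma inner_Lmat:
  "Y \<bullet> (Lmat C z ** Y) = (\<Sum>i\<in>UNIV. (z $ i * (C *v z) $ i) * (norm (Y $ i))\<^sup>2) - Y \<bullet> (C ** Y)"
  by (simp add: inner_vec_def[of Y] Lmat_mult_row inner_diff_right sum_subtractf power2_norm_eq_inner)

text \<open>\<open>A\<close> acts on each column of \<open>Y\<close> separately, so the form is a
  sum of quadratic forms of columns.\<close>

lemma pos_semidef_inner_matrix_mult:
  fixes Y :: "real^'r^'n"
  assumes "pos_semidef A"
  shows "0 \<le> Y \<bullet> (A ** Y)"
proof -
  have "Y \<bullet> (A ** Y) = (\<Sum>i\<in>UNIV. \<Sum>k\<in>UNIV. Y $ i $ k * (A *v column k Y) $ i)"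
    by (simp add: inner_vec_def matrix_matrix_mult_def matrix_vector_mult_def column_def)
  also have "\<dots> = (\<Sum>k\<in>UNIV. column k Y \<bullet> (A *v column k Y))"
    by (subst sum.swap) (simp add: inner_vec_def column_def)
  finally have "Y \<bullet> (A ** Y) = (\<Sum>k\<in>UNIV. column k Y \<bullet> (A *v column k Y))" .
  then show ?thesis
    using assms by (simp add: pos_semidef_def sum_nonneg)
qed

lemma diag_inv_sqrt_mult_vec: "(diag_inv_sqrt D *v x) $ i = x $ i / sqrt (D $ i $ i)"
  by (simp add: diag_inv_sqrt_def matrix_vector_mult_def if_distrib if_distribR cong: if_cong)

lemma symmetric_mat_diag_inv_sqrt: "symmetric_mat (diag_inv_sqrt D)"
  by (simp add: symmetric_mat_def diag_inv_sqrt_def transpose_def vec_eq_iff)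

lemma LDmat_mult_vec:
  "LDmat D C z *v x = diag_inv_sqrt D *v (Lmat C z *v (diag_inv_sqrt D *v x))"
  by (simp add: LDmat_def matrix_vector_mul_assoc matrix_mul_assoc)

lemma LDmat_quadratic_form:
  "x \<bullet> (LDmat D C z *v x) = (diag_inv_sqrt D *v x) \<bullet> (Lmat C z *v (diag_inv_sqrt D *v x))"
  by (simp add: LDmat_mult_vec symmetric_mat_adjoint[OF symmetric_mat_diag_inv_sqrt])

lemma pos_semidef_LDmat:
  assumes "pos_semidef (Lmat C z)"
  shows "pos_semidef (LDmat D C z)"
proof -
  have "symmetric_mat (LDmat D C z)"
    using assms symmetric_mat_diag_inv_sqrt[of D]
    by (simp add: pos_semidef_def symmetric_mat_def LDmat_def matrix_transpose_mul matrix_mul_assoc)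
  then show ?thesis
    using assms by (simp add: pos_semidef_def LDmat_quadratic_form)
qed

lemma quadratic_form_diff_kernel:
  assumes "symmetric_mat A" "A *v z = 0"
  shows "(x - c *\<^sub>R z) \<bullet> (A *v (x - c *\<^sub>R z)) = x \<bullet> (A *v x)"
proof -
  have "A *v (x - c *\<^sub>R z) = A *v x"
    by (simp add: matrix_vector_mult_diff_distrib matrix_vector_mult_scaleR assms(2))
  moreover have "z \<bullet> (A *v x) = 0"
    using symmetric_mat_adjoint[OF assms(1), of z x] assms(2) by simp
  ultimately show ?thesis
    by (simp add: inner_diff_left)
qed

text \<open>The kernel of \<open>Lmat C z\<close> is the line through \<open>z\<close>, so the
  kernel of \<open>LDmat D C z\<close> is the line through \<open>q\<close>, which is
  \<open>z\<close> scaled by the square root of \<open>D\<close>; \<open>eigval_2_pos\<close> then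
  applies.\<close>

lemma eigval_2_LDmat_pos:
  fixes C D :: "real^'n^'n"
  assumes n: "CARD('n) \<ge> 2" and z: "\<And>i. (z $ i)\<^sup>2 = 1"
    and psd: "pos_semidef (Lmat C z)" and pos: "eigval 2 (Lmat C z) > 0" and D: "\<And>i. 0 < D $ i $ i"
  shows "eigval 2 (LDmat D C z) > 0"
proof (rule eigval_2_pos[OF n pos_semidef_LDmat[OF psd]])
  let ?L = "Lmat C z" and ?R = "diag_inv_sqrt D"
  define q where "q = (\<chi> i. sqrt (D $ i $ i) * z $ i)"
  have Lz: "?L *v z = 0"
    using z by (rule Lmat_mult_vec_sign)
  have sym: "symmetric_mat ?L"
    using psd by (simp add: pos_semidef_def)
  have z0: "z \<noteq> 0"
    using z[of undefined] by auto
  have q0: "q \<noteq> 0"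
  proof
    assume "q = 0"
    then have "q $ i = 0" for i
      by simp
    from this[of undefined] show False
      using D[of undefined] z[of undefined] by (auto simp: q_def)
  qed
  \<comment> \<open>Removing from \<open>?k\<close> its component along \<open>z\<close> leaves the
    quadratic form at 0, while \<open>eigval 2 ?L > 0\<close> controls the remainder; so the
    remainder vanishes.\<close>
  have kernel: "\<exists>c. x = c *\<^sub>R q" if "LDmat D C z *v x = 0" for x
  proof -
    let ?k = "?R *v x"
    define c where "c = (?k \<bullet> z) / (z \<bullet> z)"
    have "(?k - c *\<^sub>R z) \<bullet> z = 0"
      using z0 by (simp add: c_def inner_diff_left)
    then have "eigval 2 ?L * ((?k - c *\<^sub>R z) \<bullet> (?k - c *\<^sub>R z))
        \<le> (?k - c *\<^sub>R z) \<bullet> (?L *v (?k - c *\<^sub>R z))"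
      by (rule quadratic_form_ge_eigval_2[OF n psd Lz z0])
    also have "\<dots> = x \<bullet> (LDmat D C z *v x)"
      by (simp only: quadratic_form_diff_kernel[OF sym Lz] LDmat_quadratic_form)
    finally have "eigval 2 ?L * ((?k - c *\<^sub>R z) \<bullet> (?k - c *\<^sub>R z)) \<le> 0"
      using that by simp
    then have "(?k - c *\<^sub>R z) \<bullet> (?k - c *\<^sub>R z) \<le> 0"
      using pos by (simp add: mult_le_0_iff)
    then have "?k = c *\<^sub>R z"
      by (metis eq_iff_diff_eq_0 inner_gt_zero_iff not_less)
    then have "?k $ i = c * z $ i" for i
      by simp
    then have "x $ i / sqrt (D $ i $ i) = c * z $ i" for i
      by (simp add: diag_inv_sqrt_mult_vec)
    then have "x $ i = c * (sqrt (D $ i $ i) * z $ i)" for i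
      using D[of i] by (simp add: divide_eq_eq mult_ac)
    then have "x = c *\<^sub>R q"
      by (simp add: vec_eq_iff q_def)
    then show ?thesis ..
  qed
  fix x y assume "LDmat D C z *v x = 0" "LDmat D C z *v y = 0" and orth: "x \<bullet> y = 0"
  then obtain c c' where "x = c *\<^sub>R q" "y = c' *\<^sub>R q"
    using kernel by blast
  with orth q0 show "x = 0 \<or> y = 0"
    by auto
qed

text \<open>Centre \<open>x\<close> at its weighted mean \<open>m\<close>, multiply by the signs
  \<open>z\<close> and by the square root of \<open>D\<close> to get \<open>v\<close>. The square
  root cancels in the form of \<open>LDmat D C z\<close>, and centring subtracts a multiple of the
  kernel vector \<open>z\<close>, so the form at \<open>v\<close> is \<open>Q\<close>. Moreover
  \<open>v \<bullet> v = \<delta> * E\<close>, and the choice of \<open>m\<close> makes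
  \<open>v\<close> orthogonal to the kernel vector \<open>q\<close>, which brings in the second
  eigenvalue.\<close>

lemma LDmat_variance_bounds:
  fixes C D :: "real^'n^'n" and x :: "'n \<Rightarrow> real"
  assumes n: "CARD('n) \<ge> 2" and z: "\<And>i. (z $ i)\<^sup>2 = 1"
    and psd: "pos_semidef (Lmat C z)" and D: "\<And>i. 0 < D $ i $ i"
  defines "\<delta> \<equiv> \<Sum>i\<in>UNIV. D $ i $ i"
  defines "Q \<equiv> \<Sum>i\<in>UNIV. \<Sum>j\<in>UNIV. (z $ i * z $ j * Lmat C z $ i $ j) * (x i * x j)"
    and "E \<equiv> \<Sum>i\<in>UNIV. (D $ i $ i / \<delta>) * (x i - (\<Sum>k\<in>UNIV. (D $ k $ k / \<delta>) * x k))\<^sup>2"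
  shows "\<delta> * eigval 2 (LDmat D C z) * E \<le> Q"
    and "Q \<le> \<delta> * eigval CARD('n) (LDmat D C z) * E"
proof -
  let ?L = "Lmat C z" and ?R = "diag_inv_sqrt D"
  define m where "m = (\<Sum>k\<in>UNIV. (D $ k $ k / \<delta>) * x k)"
  define X where "X = (\<chi> i. z $ i * x i)"
  define v where "v = (\<chi> i. sqrt (D $ i $ i) * (z $ i * (x i - m)))"
  define q where "q = (\<chi> i. sqrt (D $ i $ i) * z $ i)"
  have sym: "symmetric_mat ?L"
    using psd by (simp add: pos_semidef_def)
  have psd': "pos_semidef (LDmat D C z)"
    using psd by (rule pos_semidef_LDmat)
  have Lz: "?L *v z = 0"
    using z by (rule Lmat_mult_vec_sign)
  have \<delta>: "0 < \<delta>"
    unfolding \<delta>_def using D by (intro sum_pos) auto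
  have sqrtD: "sqrt (D $ i $ i) \<noteq> 0" "sqrt (D $ i $ i) * sqrt (D $ i $ i) = D $ i $ i" for i
    using D[of i] by auto
  have zz: "z $ i * z $ i = 1" for i
    using z[of i] by (simp add: power2_eq_square)
  have "?R *v v = X - m *\<^sub>R z"
  proof -
    have "(?R *v v) $ i = z $ i * (x i - m)" for i
      using sqrtD(1)[of i] by (simp add: diag_inv_sqrt_mult_vec v_def)
    then show ?thesis
      by (simp add: vec_eq_iff X_def algebra_simps)
  qed
  moreover have "Q = X \<bullet> (?L *v X)"
    by (simp add: Q_def X_def inner_vec_def matrix_vector_mult_def sum_distrib_left mult_ac)
  ultimately have Q: "Q = v \<bullet> (LDmat D C z *v v)"
    by (simp add: LDmat_quadratic_form quadratic_form_diff_kernel[OF sym Lz])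
  have "v \<bullet> v = (\<Sum>i\<in>UNIV. D $ i $ i * (x i - m)\<^sup>2)"
  proof -
    have "v $ i * v $ i = (sqrt (D $ i $ i) * sqrt (D $ i $ i)) * (z $ i * z $ i) * (x i - m)\<^sup>2" for i
      by (simp add: v_def power2_eq_square mult_ac del: real_sqrt_mult_self)
    then show ?thesis
      by (simp add: inner_vec_def zz sqrtD(2) del: real_sqrt_mult_self)
  qed
  also have "\<dots> = \<delta> * E"
    using \<delta> by (simp add: E_def m_def sum_distrib_left)
  finally have vv: "v \<bullet> v = \<delta> * E" .
  have "?R *v q = z"
    using sqrtD(1) by (simp add: vec_eq_iff diag_inv_sqrt_mult_vec q_def)
  then have q: "LDmat D C z *v q = 0" "q \<noteq> 0"
    using Lz zz[of undefined] by (auto simp: LDmat_mult_vec)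
  have "v \<bullet> q = (\<Sum>i\<in>UNIV. D $ i $ i * (x i - m))"
  proof -
    have "v $ i * q $ i = (sqrt (D $ i $ i) * sqrt (D $ i $ i)) * (z $ i * z $ i) * (x i - m)" for i
      by (simp add: v_def q_def mult_ac del: real_sqrt_mult_self)
    then show ?thesis
      by (simp add: inner_vec_def zz sqrtD(2) del: real_sqrt_mult_self)
  qed
  also have "\<dots> = (\<Sum>i\<in>UNIV. D $ i $ i * x i) - \<delta> * m"
    by (simp add: right_diff_distrib sum_subtractf \<delta>_def sum_distrib_right)
  also have "\<delta> * m = (\<Sum>i\<in>UNIV. D $ i $ i * x i)"
    using \<delta> by (simp add: m_def sum_distrib_left)
  finally have "v \<bullet> q = 0"
    by simp
  from quadratic_form_ge_eigval_2[OF n psd' q this]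
  show "\<delta> * eigval 2 (LDmat D C z) * E \<le> Q"
    by (simp add: Q vv mult_ac)
  show "Q \<le> \<delta> * eigval CARD('n) (LDmat D C z) * E"
    using quadratic_form_le_eigval_max[of "LDmat D C z" v] psd'
    by (simp add: Q vv mult_ac pos_semidef_def)
qed

section \<open>Transfer to the optimization problem\<close>

theorem theorem2p1:
  fixes C D :: "real^'n^'n" and z :: "real^'n" and Y :: "real^'r^'n"
  assumes "CARD('n) \<ge> 2"
    and "symmetric_mat C"
    and "\<And>i. z $ i \<in> {-1, 1}"
    and "pos_semidef (Lmat C z)"
    and "eigval 2 (Lmat C z) > 0"
    and "diagonal_mat D" and "pos_def D"
    and "real CARD('r) > eigval CARD('n) (LDmat D C z) / eigval 2 (LDmat D C z)"
    and "second_order_critical C Y"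
  shows "global_opt C Y \<and> Y ** transpose Y = outer z"
proof -
  let ?L = "Lmat C z" and ?LD = "LDmat D C z"
  note n = assms(1) and C = assms(2) and psd = assms(4) and crit = assms(9)
  define d where "d i = D $ i $ i" for i
  define \<delta> where "\<delta> = (\<Sum>i\<in>UNIV. d i)"
  define \<gamma> where "\<gamma> i = z $ i * (C *v z) $ i" for i
  define g where "g i = (C ** Y) $ i \<bullet> Y $ i" for i
  define y where "y i = z $ i *\<^sub>R Y $ i" for i
  define a where "a i j = z $ i * z $ j * ?L $ i $ j" for i j
  have d: "0 < d i" for i
    using pos_def_diagonal[OF assms(7)] by (simp add: d_def)
  have z: "(z $ i)\<^sup>2 = 1" for i
    using assms(3)[of i] by auto
  have zz: "z $ i * z $ i = 1" for i
    using z[of i] by (simp add: power2_eq_square)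
  have sym: "symmetric_mat ?L" and sym_LD: "symmetric_mat ?LD"
    using psd pos_semidef_LDmat[OF psd] by (auto simp: pos_semidef_def)
  have Lz: "?L *v z = 0"
    using z by (rule Lmat_mult_vec_sign)
  have \<delta>: "0 < \<delta>"
    unfolding \<delta>_def using d by (intro sum_pos) auto
  have eig2: "0 < eigval 2 ?LD"
    using n z psd assms(5) d unfolding d_def by (rule eigval_2_LDmat_pos)
  have feas: "norm (Y $ i) = 1" for i
    using crit by (simp add: second_order_critical_def feasible_iff_norm)
  have crit1: "(C ** Y) $ i = g i *\<^sub>R Y $ i" for i
    unfolding g_def by (rule second_order_critical_conditions(1)[OF C crit])
  have a_row: "(\<Sum>j\<in>UNIV. a i j *\<^sub>R (z $ j *\<^sub>R W $ j)) = z $ i *\<^sub>R (?L ** W) $ i" for W :: "real^'r^'n" and i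
  proof -
    have "a i j * z $ j = (z $ j * z $ j) * (z $ i * ?L $ i $ j)" for j
      by (simp add: a_def)
    then have "a i j * z $ j = z $ i * ?L $ i $ j" for j
      by (simp add: zz)
    then show ?thesis
      by (simp add: matrix_mult_row scaleR_sum_right)
  qed
  have const: "y i = (\<Sum>k\<in>UNIV. (d k / \<delta>) *\<^sub>R y k)" for i
  \<comment> \<open>First-order criticality makes row \<open>i\<close> of \<open>?L ** Y\<close>
    equal to \<open>(\<gamma> i - g i) *\<^sub>R Y $ i\<close>, which identifies \<Gamma>. The
    factor \<delta> in both bounds compensates for normalising the weights to sum 1.\<close>
  proof (rule critical_vectors_constant[where a = a and \<Gamma> = "\<lambda>i. \<gamma> i - g i"
        and l = "\<delta> * eigval 2 ?LD" and u = "\<delta> * eigval CARD('n) ?LD"])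
    show "a i j = a j i" for i j
    proof -
      have "transpose ?L $ i $ j = ?L $ i $ j"
        using sym by (simp add: symmetric_mat_def)
      then show ?thesis
        by (simp add: a_def transpose_def)
    qed
    show "(\<Sum>j\<in>UNIV. a i j) = 0" for i
    proof -
      have "(\<Sum>j\<in>UNIV. a i j) = z $ i * (?L *v z) $ i"
        by (simp add: a_def matrix_vector_mult_def sum_distrib_left mult_ac)
      then show ?thesis
        by (simp add: Lz)
    qed
    show "0 < d i / \<delta>" for i
      using d \<delta> by simp
    show "(\<Sum>i\<in>UNIV. d i / \<delta>) = 1"
      using \<delta> by (simp add: sum_divide_distrib[symmetric] \<delta>_def)
    show "\<delta> * eigval 2 ?LD * (\<Sum>i\<in>UNIV. (d i / \<delta>) * (x i - (\<Sum>k\<in>UNIV. (d k / \<delta>) * x k))\<^sup>2)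
        \<le> (\<Sum>i\<in>UNIV. \<Sum>j\<in>UNIV. a i j * (x i * x j))"
      "(\<Sum>i\<in>UNIV. \<Sum>j\<in>UNIV. a i j * (x i * x j))
        \<le> \<delta> * eigval CARD('n) ?LD * (\<Sum>i\<in>UNIV. (d i / \<delta>) * (x i - (\<Sum>k\<in>UNIV. (d k / \<delta>) * x k))\<^sup>2)"
      for x
      using LDmat_variance_bounds[OF n z psd d[unfolded d_def], of x]
      by (simp_all only: a_def d_def[abs_def] \<delta>_def)
    show "\<delta> * eigval 2 ?LD \<le> \<delta> * eigval CARD('n) ?LD"
      using \<delta> n by (simp add: eigval_mono[OF sym_LD])
    show "0 < \<delta> * eigval 2 ?LD"
      using \<delta> eig2 by simp
    have "eigval CARD('n) ?LD < real CARD('r) * eigval 2 ?LD"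
      using assms(8) eig2 by (simp add: pos_divide_less_eq)
    then have "\<delta> * eigval CARD('n) ?LD < \<delta> * (real CARD('r) * eigval 2 ?LD)"
      using \<delta> by (rule mult_strict_left_mono)
    then show "\<delta> * eigval CARD('n) ?LD < real CARD('r) * (\<delta> * eigval 2 ?LD)"
      by (simp only: mult.left_commute)
    show "norm (y i) = 1" for i
      using assms(3)[of i] feas[of i] by (auto simp: y_def)
    show "(\<Sum>j\<in>UNIV. a i j *\<^sub>R y j) = (\<gamma> i - g i) *\<^sub>R y i" for i
      unfolding y_def a_row Lmat_mult_row crit1 \<gamma>_def by (simp add: algebra_simps)
    fix V :: "'n \<Rightarrow> real^'r"
    assume V: "\<And>i. y i \<bullet> V i = 0"
    \<comment> \<open>Undoing the sign twist turns a family tangent at \<open>y\<close> into a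
      tangent direction at \<open>Y\<close> with the same row norms.\<close>
    define W where "W = (\<chi> i. z $ i *\<^sub>R V i)"
    have W: "norm (W $ i) = norm (V i)" "Y $ i \<bullet> W $ i = 0" for i
      using assms(3)[of i] V[of i] by (auto simp: W_def y_def)
    have "(\<Sum>i\<in>UNIV. (\<gamma> i - g i) * (norm (V i))\<^sup>2)
        = (\<Sum>i\<in>UNIV. \<gamma> i * (norm (W $ i))\<^sup>2) - (\<Sum>i\<in>UNIV. g i * (norm (W $ i))\<^sup>2)"
      by (simp add: W(1) left_diff_distrib sum_subtractf)
    also have "\<dots> \<le> W \<bullet> (?L ** W)"
      using second_order_critical_conditions(2)[OF C crit W(2)]
      by (simp add: inner_Lmat \<gamma>_def g_def)
    also have "\<dots> = (\<Sum>i\<in>UNIV. \<Sum>j\<in>UNIV. a i j * (V i \<bullet> V j))"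
      by (simp add: inner_matrix_mult W_def a_def mult_ac)
    finally show "(\<Sum>i\<in>UNIV. (\<gamma> i - g i) * (norm (V i))\<^sup>2)
        \<le> (\<Sum>i\<in>UNIV. \<Sum>j\<in>UNIV. a i j * (V i \<bullet> V j))" .
  qed
  have "Y $ i \<bullet> Y $ j = z $ i * z $ j" for i j
  proof -
    have Yz: "Y $ i = z $ i *\<^sub>R y i" for i
      by (simp add: y_def zz)
    have "y j = y i"
      using const by metis
    moreover have "y i \<bullet> y i = 1"
      using feas[of i] zz[of i] by (simp add: y_def norm_eq_1)
    ultimately show ?thesis
      by (simp add: Yz)
  qed
  then have YY: "Y ** transpose Y = outer z"
    by (simp add: vec_eq_iff outer_def matrix_matrix_mult_def transpose_def inner_vec_def)
  \<comment> \<open>With unit rows the objective is a constant minus a nonnegative form, so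
    \<open>Y\<close> is optimal once it attains that constant.\<close>
  have obj: "objective C W = sum \<gamma> UNIV - W \<bullet> (?L ** W)" if "feasible W" for W :: "real^'r^'n"
    using that by (simp add: objective_eq_inner inner_Lmat feasible_iff_norm \<gamma>_def)
  have "objective C Y = sum \<gamma> UNIV"
  proof -
    have "objective C Y = (\<Sum>i\<in>UNIV. \<Sum>j\<in>UNIV. C $ i $ j * (z $ i * z $ j))"
      by (simp add: objective_def YY inner_vec_def outer_def)
    then show ?thesis
      by (simp add: \<gamma>_def matrix_vector_mult_def sum_distrib_left mult_ac)
  qed
  then have "objective C W \<le> objective C Y" if "feasible W" for W :: "real^'r^'n"
    using obj[OF that] pos_semidef_inner_matrix_mult[OF psd, of W] by simp
  then have "global_opt C Y"
    using crit by (auto simp: global_opt_def is_arg_max_def second_order_critical_def not_less)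
  with YY show ?thesis
    by simp
qed

end
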